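(* Let $R$ be a $v$-domain. If $R$ is Boole $t$-regular, then $R$ is a GCD domain of finite $t$-character.
   Context: All rings are integral domains (commutative with identity). Let $R$ be a domain with quotient field $K$. For nonzero fractional ideals (more generally, nonzero $R$-submodules of $K$) $I,J$, put $(I:J)=\{x\in K\mid xJ\subseteq I\}$, $I^{-1}=(R:I)$, $I_v=(I^{-1})^{-1}$, and $I_t=\bigcup J_v$, where $J$ ranges over the nonzero finitely generated subideals of $I$. A nonzero fractional ideal $I$ is a (fractional) $t$-ideal if $I_t=I$. A $t$-maximal ideal is an ideal that is maximal among the proper integral $t$-ideals of $R$. - $R$ is a $v$-domain if $(I_v:I_v)=R$ for each nonzero finitely generated ideal $I$ of $R$. - The $t$-class semigroup $S_t(R)$ is the semigroup of fractional $t$-ideals of $R$, with multiplication $(I,J)\mapsto (IJ)_t$, modulo its subsemigroup of nonzero principal fractional ideals (so $I$ and $J$ have the same class iff $I=cJ$ for some $0\neq c\in K$). $R$ is Boole $t$-regular if $S_t(R)$ is a Boolean semigroup, i.e. $x^2=x$ for all $x\in S_t(R)$; equivalently, for every fractional $t$-ideal $I$ of $R$ there is $0\ne c\in K$ with $(I^2)_t=cI$. - $R$ is a GCD domain if every pair of nonzero elements of $R$ has a greatest common divisor; equivalently, $I_t$ is principal for every nonzero finitely generated fractional ideal $I$ of $R$. - $R$ is of finite $t$-character if each proper (nonzero, integral) $t$-ideal of $R$ is contained in only finitely many $t$-maximal ideals of $R$. *)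

theory Defs
  imports "HOL-Computational_Algebra.Polynomial_Factorial"
begin

text \<open>
  The domain \<open>R\<close> is a type \<open>'a\<close> of class \<^class>\<open>idom\<close>, its quotient field \<open>K\<close> is \<open>'a fract\<close>,
  and \<open>R\<close> sits inside \<open>K\<close> as the range of \<^const>\<open>to_fract\<close>.  Properties of the ring as a whole
  take the type as an argument, e.g. \<open>v_domain TYPE('a)\<close>.
\<close>

global_interpretation fract_module: module "\<lambda>(r :: 'a :: idom) (x :: 'a fract). to_fract r * x"
  defines submodule = fract_module.subspace and submodule_span = fract_module.span
  by unfold_locales (simp_all add: algebra_simps)

abbreviation base_ring :: "'a :: idom fract set" where
  "base_ring \<equiv> range to_fract"

definition fractional_ideal :: "'a :: idom fract set \<Rightarrow> bool" where
  "fractional_ideal I \<longleftrightarrow>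
     submodule I \<and> (\<exists>d. d \<noteq> 0 \<and> (\<forall>x\<in>I. to_fract d * x \<in> base_ring))"

definition fin_gen :: "'a :: idom fract set \<Rightarrow> bool" where
  "fin_gen I \<longleftrightarrow> (\<exists>F. finite F \<and> I = submodule_span F)"

definition ideal_scale :: "'a :: idom fract \<Rightarrow> 'a fract set \<Rightarrow> 'a fract set" where
  "ideal_scale c I = (\<lambda>x. c * x) ` I"

definition ideal_mult :: "'a :: idom fract set \<Rightarrow> 'a fract set \<Rightarrow> 'a fract set" where
  "ideal_mult I J = submodule_span {x * y | x y. x \<in> I \<and> y \<in> J}"

definition colon :: "'a :: idom fract set \<Rightarrow> 'a fract set \<Rightarrow> 'a fract set" where
  "colon I J = {x. \<forall>y\<in>J. x * y \<in> I}"

definition ideal_inv :: "'a :: idom fract set \<Rightarrow> 'a fract set" where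
  "ideal_inv I = colon base_ring I"

definition v_closure :: "'a :: idom fract set \<Rightarrow> 'a fract set" where
  "v_closure I = ideal_inv (ideal_inv I)"

definition t_closure :: "'a :: idom fract set \<Rightarrow> 'a fract set" where
  "t_closure I = \<Union> {v_closure J | J. fin_gen J \<and> J \<noteq> {0} \<and> J \<subseteq> I}"

definition t_ideal :: "'a :: idom fract set \<Rightarrow> bool" where
  "t_ideal I \<longleftrightarrow> fractional_ideal I \<and> I \<noteq> {0} \<and> t_closure I = I"

definition t_maximal :: "'a :: idom fract set \<Rightarrow> bool" where
  "t_maximal M \<longleftrightarrow> t_ideal M \<and> M \<subset> base_ring \<and>
     (\<forall>I. t_ideal I \<and> I \<subset> base_ring \<and> M \<subseteq> I \<longrightarrow> I = M)"

definition v_domain :: "'a :: idom itself \<Rightarrow> bool" where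
  "v_domain _ \<longleftrightarrow> (\<forall>I :: 'a fract set. fin_gen I \<and> I \<noteq> {0} \<and> I \<subseteq> base_ring \<longrightarrow>
     colon (v_closure I) (v_closure I) = base_ring)"

text \<open>The \<open>t\<close>-class semigroup: its carrier consists of the classes of fractional \<open>t\<close>-ideals up to
  nonzero scalars, and its multiplication is induced by \<open>(I, J) \<mapsto> (I J)\<^sub>t\<close>.\<close>

definition t_class_rel :: "('a :: idom fract set \<times> 'a fract set) set" where
  "t_class_rel = {(I, J). t_ideal I \<and> t_ideal J \<and> (\<exists>c. c \<noteq> 0 \<and> I = ideal_scale c J)}"

definition t_class_semigroup :: "'a :: idom fract set set set" where
  "t_class_semigroup = {I. t_ideal I} // t_class_rel"

definition t_class_mult ::
    "'a :: idom fract set set \<Rightarrow> 'a fract set set \<Rightarrow> 'a fract set set" where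
  "t_class_mult X Y = (\<Union>I\<in>X. \<Union>J\<in>Y. t_class_rel `` {t_closure (ideal_mult I J)})"

definition boole_t_regular :: "'a :: idom itself \<Rightarrow> bool" where
  "boole_t_regular _ \<longleftrightarrow> (\<forall>X \<in> (t_class_semigroup :: 'a fract set set set). t_class_mult X X = X)"

definition gcd_domain :: "'a :: idom itself \<Rightarrow> bool" where
  "gcd_domain _ \<longleftrightarrow> (\<forall>a b :: 'a. a \<noteq> 0 \<and> b \<noteq> 0 \<longrightarrow>
     (\<exists>g. g dvd a \<and> g dvd b \<and> (\<forall>d. d dvd a \<and> d dvd b \<longrightarrow> d dvd g)))"

definition finite_t_character :: "'a :: idom itself \<Rightarrow> bool" where
  "finite_t_character _ \<longleftrightarrow> (\<forall>I :: 'a fract set. t_ideal I \<and> I \<subset> base_ring \<longrightarrow>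
     finite {M. t_maximal M \<and> I \<subseteq> M})"


text \<open>The class multiplication is well defined, and Boole \<open>t\<close>-regularity unfolds to the
  elementwise condition.\<close>

lemma ideal_scale_scale: "ideal_scale c (ideal_scale d I) = ideal_scale (c * d) I"
  by (auto simp: ideal_scale_def image_image mult.assoc)

lemma ideal_scale_1 [simp]: "ideal_scale 1 I = I"
  by (simp add: ideal_scale_def)

lemma ideal_scale_inverse:
  "c \<noteq> 0 \<Longrightarrow> ideal_scale (inverse c) (ideal_scale c I) = I"
  "c \<noteq> 0 \<Longrightarrow> ideal_scale c (ideal_scale (inverse c) I) = I"
  by (simp_all add: ideal_scale_scale)

lemma module_hom_scale:
  "module_hom (\<lambda>(r :: 'a :: idom) x. to_fract r * x) (\<lambda>r x. to_fract r * x) (\<lambda>x :: 'a fract. c * x)"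
  by (intro module_hom.intro module_hom_axioms.intro fract_module.module_axioms)
     (simp_all add: algebra_simps)

lemma submodule_span_scale:
  "submodule_span (ideal_scale c F) = ideal_scale c (submodule_span F)"
  unfolding ideal_scale_def submodule_span_def
  by (rule module_hom.span_image [OF module_hom_scale])

lemma ideal_mult_scale:
  "ideal_mult (ideal_scale c I) (ideal_scale d J) = ideal_scale (c * d) (ideal_mult I J)"
proof -
  have "{x * y | x y. x \<in> ideal_scale c I \<and> y \<in> ideal_scale d J} =
        ideal_scale (c * d) {x * y | x y. x \<in> I \<and> y \<in> J}" (is "?A = ?B")
  proof
    show "?A \<subseteq> ?B"
      by (force simp: ideal_scale_def mult_ac)
    show "?B \<subseteq> ?A"
    proof
      fix z assume "z \<in> ?B"
      then obtain x y where "z = c * d * (x * y)" "x \<in> I" "y \<in> J"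
        by (auto simp: ideal_scale_def)
      moreover have "c * d * (x * y) = (c * x) * (d * y)"
        by (simp add: mult_ac)
      ultimately have "z = (c * x) * (d * y)" "x \<in> I" "y \<in> J"
        by simp_all
      then show "z \<in> ?A"
        by (auto simp: ideal_scale_def)
    qed
  qed
  then show ?thesis
    by (simp add: ideal_mult_def submodule_span_scale)
qed

lemma ideal_inv_scale: 
  assumes "c \<noteq> 0"
  shows "ideal_inv (ideal_scale c I) = ideal_scale (inverse c) (ideal_inv I)"
proof
  show "ideal_inv (ideal_scale c I) \<subseteq> ideal_scale (inverse c) (ideal_inv I)"
  proof
    fix x assume "x \<in> ideal_inv (ideal_scale c I)"
    then have "c * x \<in> ideal_inv I"
      by (auto simp: ideal_inv_def colon_def ideal_scale_def mult_ac)
    moreover have "x = inverse c * (c * x)"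
      using assms by simp
    ultimately show "x \<in> ideal_scale (inverse c) (ideal_inv I)"
      unfolding ideal_scale_def by blast
  qed
  show "ideal_scale (inverse c) (ideal_inv I) \<subseteq> ideal_inv (ideal_scale c I)"
    using assms by (auto simp: ideal_inv_def colon_def ideal_scale_def field_simps)
qed

lemma v_closure_scale: "c \<noteq> 0 \<Longrightarrow> v_closure (ideal_scale c I) = ideal_scale c (v_closure I)"
  by (simp add: v_closure_def ideal_inv_scale)

lemma fin_gen_scale: "fin_gen J \<Longrightarrow> fin_gen (ideal_scale c J)"
  unfolding fin_gen_def
  by (metis submodule_span_scale finite_imageI ideal_scale_def)

lemma ideal_scale_eq_zero_iff: "c \<noteq> 0 \<Longrightarrow> ideal_scale c I = {0} \<longleftrightarrow> I = {0}"
  by (metis ideal_scale_inverse(1) ideal_scale_def image_empty image_insert mult_zero_right)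

lemma ideal_scale_mono: "I \<subseteq> J \<Longrightarrow> ideal_scale c I \<subseteq> ideal_scale c J"
  by (auto simp: ideal_scale_def)

lemma t_closure_scale:
  assumes "c \<noteq> 0"
  shows "t_closure (ideal_scale c I) = ideal_scale c (t_closure I)"
proof -
  have sub: "ideal_scale d (t_closure L) \<subseteq> t_closure (ideal_scale d L)"
    if d: "d \<noteq> 0" for d :: "'a fract" and L
  proof
    fix x assume "x \<in> ideal_scale d (t_closure L)"
    then obtain J where J: "fin_gen J" "J \<noteq> {0}" "J \<subseteq> L" "x \<in> ideal_scale d (v_closure J)"
      by (auto simp: ideal_scale_def t_closure_def)
    then have "x \<in> v_closure (ideal_scale d J)"
      by (simp add: v_closure_scale d)
    moreover have "fin_gen (ideal_scale d J)" "ideal_scale d J \<noteq> {0}"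
        "ideal_scale d J \<subseteq> ideal_scale d L"
      using J d by (simp_all add: fin_gen_scale ideal_scale_eq_zero_iff ideal_scale_mono)
    ultimately show "x \<in> t_closure (ideal_scale d L)"
      unfolding t_closure_def by blast
  qed
  have "ideal_scale c (ideal_scale (inverse c) (t_closure (ideal_scale c I)))
          \<subseteq> ideal_scale c (t_closure (ideal_scale (inverse c) (ideal_scale c I)))"
    using assms by (intro ideal_scale_mono sub) simp
  then show ?thesis
    using sub [OF assms, of I] assms by (simp add: ideal_scale_inverse)
qed

lemma fractional_ideal_scale:
  assumes "fractional_ideal I"
  shows "fractional_ideal (ideal_scale c I)"
proof -
  obtain d where d: "d \<noteq> 0" "\<forall>x\<in>I. to_fract d * x \<in> base_ring" and I: "submodule I"
    using assms by (auto simp: fractional_ideal_def)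
  obtain a b where c: "c = Fract a b" "b \<noteq> 0"
    by (cases c) auto
  have "to_fract (b * d) * (c * x) \<in> base_ring" if "x \<in> I" for x
  proof -
    obtain r where r: "to_fract d * x = to_fract r"
      using d \<open>x \<in> I\<close> by blast
    have "to_fract b * c = to_fract a"
      using c by (simp add: to_fract_def eq_fract)
    then have "to_fract (b * d) * (c * x) = to_fract a * (to_fract d * x)"
      by (simp add: mult_ac flip: \<open>to_fract b * c = to_fract a\<close>)
    then show ?thesis
      by (metis r rangeI to_fract_mult)
  qed
  moreover have "submodule (ideal_scale c I)"
    using I module_hom.subspace_image [OF module_hom_scale, of I c]
    by (simp add: ideal_scale_def submodule_def)
  ultimately show ?thesis
    using c d unfolding fractional_ideal_def ideal_scale_def
    by (intro conjI exI [of _ "b * d"]) auto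
qed

lemma t_ideal_scale: "c \<noteq> 0 \<Longrightarrow> t_ideal I \<Longrightarrow> t_ideal (ideal_scale c I)"
  by (simp add: t_ideal_def fractional_ideal_scale ideal_scale_eq_zero_iff t_closure_scale)

lemma equiv_t_class_rel: "equiv {I. t_ideal I} t_class_rel"
proof (rule equivI)
  show "t_class_rel \<subseteq> {I. t_ideal I} \<times> {I. t_ideal I}"
    by (auto simp: t_class_rel_def)
  show "refl_on {I. t_ideal I} t_class_rel"
    by (auto simp: refl_on_def t_class_rel_def intro: exI [of _ 1])
  show "sym t_class_rel"
    by (auto simp: sym_def t_class_rel_def)
       (metis ideal_scale_inverse(1) nonzero_imp_inverse_nonzero)
  show "trans t_class_rel"
    by (auto simp: trans_def t_class_rel_def)
       (metis ideal_scale_scale mult_eq_0_iff)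
qed

lemma t_class_mult_respects:
  "(\<lambda>I J. t_class_rel `` {t_closure (ideal_mult I J)}) respects2 t_class_rel"
proof (rule congruent2I')
  fix I I' J J' :: "'a fract set"
  assume "(I, I') \<in> t_class_rel" "(J, J') \<in> t_class_rel"
  then obtain c d where cd: "c \<noteq> 0" "d \<noteq> 0" "I = ideal_scale c I'" "J = ideal_scale d J'"
    by (auto simp: t_class_rel_def)
  let ?L = "t_closure (ideal_mult I J)" and ?L' = "t_closure (ideal_mult I' J')"
  have L: "?L = ideal_scale (c * d) ?L'" and L': "?L' = ideal_scale (inverse (c * d)) ?L"
    using cd by (simp_all add: ideal_mult_scale t_closure_scale ideal_scale_inverse
      del: inverse_mult_distrib)
  have nz: "c * d \<noteq> 0"
    using cd by simp
  have "t_ideal ?L \<longleftrightarrow> t_ideal ?L'"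
    using L L' nz t_ideal_scale nonzero_imp_inverse_nonzero by metis
  then consider "(?L, ?L') \<in> t_class_rel" | "\<not> t_ideal ?L" "\<not> t_ideal ?L'"
    using L nz unfolding t_class_rel_def by blast
  then show "t_class_rel `` {?L} = t_class_rel `` {?L'}"
  proof cases
    case 1
    then show ?thesis
      by (rule equiv_class_eq [OF equiv_t_class_rel])
  qed (auto simp: t_class_rel_def)
qed

lemma t_class_mult_class:
  assumes "t_ideal I" "t_ideal J"
  shows "t_class_mult (t_class_rel `` {I}) (t_class_rel `` {J}) =
           t_class_rel `` {t_closure (ideal_mult I J)}"
  unfolding t_class_mult_def
  using assms UN_equiv_class2 [OF equiv_t_class_rel equiv_t_class_rel t_class_mult_respects]
  by simp

lemma boole_t_regular_iff:
  "boole_t_regular TYPE('a :: idom) \<longleftrightarrow>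
     (\<forall>I :: 'a fract set. t_ideal I \<longrightarrow> (\<exists>c. c \<noteq> 0 \<and> t_closure (ideal_mult I I) = ideal_scale c I))"
proof -
  have "t_class_rel `` {L} = t_class_rel `` {I} \<longleftrightarrow> (\<exists>c. c \<noteq> 0 \<and> L = ideal_scale c I)"
    if I: "t_ideal I" for L I :: "'a fract set"
  proof
    assume "t_class_rel `` {L} = t_class_rel `` {I}"
    moreover have "I \<in> t_class_rel `` {I}"
      using equiv_class_self [OF equiv_t_class_rel] I by blast
    ultimately show "\<exists>c. c \<noteq> 0 \<and> L = ideal_scale c I"
      by (auto simp: t_class_rel_def)
  next
    assume "\<exists>c. c \<noteq> 0 \<and> L = ideal_scale c I"
    then have "(L, I) \<in> t_class_rel"
      using I by (auto simp: t_class_rel_def t_ideal_scale)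
    then show "t_class_rel `` {L} = t_class_rel `` {I}"
      by (rule equiv_class_eq [OF equiv_t_class_rel])
  qed
  then show ?thesis
    by (auto simp: boole_t_regular_def t_class_semigroup_def quotient_def t_class_mult_class)
qed

end

theory Submission
  imports Defs
begin

text \<open>
  Both conclusions come from testing Boole regularity on a well-chosen \<open>t\<close>-ideal.

  For the GCD property the test ideal is \<open>J = (x, y)\<^sub>v\<close>.  Regularity gives \<open>(J\<^sup>2)\<^sub>t = c J\<close>, and since
  \<open>R\<close> is a \<open>v\<close>-domain, \<open>(J : J) = R\<close>; together these force \<open>J = c R\<close>
  (lemma \<open>idempotent_t_class_imp_principal\<close>).  So any two elements, not both zero, have a greatest
  common divisor in a strong sense that is stable under multiplication (\<open>v_gcd\<close>).  From here on
  \<open>t\<close>-ideals of \<open>R\<close> behave like filters for divisibility: they are closed under multiples and under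
  greatest common divisors, and directed unions of principal ideals are \<open>t\<close>-ideals.

  For finite \<open>t\<close>-character, suppose that a nonzero \<open>a\<close> lies in infinitely many \<open>t\<close>-maximal ideals.
  Any two of them contain divisors of \<open>a\<close> that are coprime to each other, and splitting off one such
  divisor at a time yields divisors \<open>s\<^sub>0, s\<^sub>1, \<dots>\<close> of \<open>a\<close> with \<open>s\<^sub>n\<^sub>+\<^sub>1 = s\<^sub>n u\<^sub>n\<close>, where the nonunit \<open>u\<^sub>n\<close> is
  coprime to \<open>s\<^sub>n\<close>, hence to all earlier \<open>u\<^sub>i\<close> (lemma \<open>infinite_coprime_factors\<close>).  Now the test ideal is the
  ascending union \<open>I\<close> of the principal ideals \<open>(a / s\<^sub>n) R\<close>, whose square has \<open>t\<close>-closure the union of the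
  \<open>(a / s\<^sub>n)\<^sup>2 R\<close>.  If this union is \<open>c I\<close>, then, \<open>c a / s\<^sub>0\<close> being in it, \<open>c\<close> is a multiple of \<open>a / s\<^sub>m\<^sup>2\<close> for
  some \<open>m\<close>; as \<open>(a / s\<^sub>m\<^sub>+\<^sub>1)\<^sup>2\<close> lies in \<open>c I\<close>, it follows that \<open>s\<^sub>m\<^sub>+\<^sub>1\<^sup>2\<close> divides \<open>s\<^sub>m\<^sup>2 s\<^sub>p\<close> for some \<open>p\<close>.
  The factor \<open>u\<^sub>m\<close> occurs twice on the left but at most once on the right, where everything else is
  coprime to it.  Hence \<open>u\<^sub>m\<close> is a unit, a contradiction
  (lemma \<open>infinite_coprime_factors_not_boole\<close>).
\<close>

section \<open>Fractional ideals and divisorial closure\<close>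

lemma mult_mem_submodule: "submodule I \<Longrightarrow> x \<in> I \<Longrightarrow> to_fract r * x \<in> I"
  by (rule fract_module.subspace_scale)

lemma submodule_base_ring: "submodule (base_ring :: 'a :: idom fract set)"
proof (rule fract_module.subspaceI)
  show "(0 :: 'a fract) \<in> base_ring"
    by (metis rangeI to_fract_0)
  show "x + y \<in> base_ring" if "x \<in> base_ring" "y \<in> base_ring" for x y :: "'a fract"
    using that by (metis (no_types, lifting) imageE rangeI to_fract_add)
  show "to_fract r * x \<in> base_ring" if "x \<in> base_ring" for r and x :: "'a fract"
    using that by (metis (no_types, lifting) imageE rangeI to_fract_mult)
qed

lemma submodule_scale: "submodule I \<Longrightarrow> submodule (ideal_scale c I)"
  using module_hom.subspace_image [OF module_hom_scale, of I c]
  by (simp add: ideal_scale_def submodule_def)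

lemma mem_principal_iff: "x \<in> ideal_scale c base_ring \<longleftrightarrow> (\<exists>r. x = c * to_fract r)"
  by (auto simp: ideal_scale_def)

lemma to_fract_mem_principal_iff:
  "to_fract x \<in> ideal_scale (to_fract g) base_ring \<longleftrightarrow> g dvd x"
  by (simp add: mem_principal_iff dvd_def flip: to_fract_mult)

lemma submodule_ideal_inv: "submodule (ideal_inv I)"
proof -
  have iff: "x \<in> ideal_inv I \<longleftrightarrow> (\<forall>z\<in>I. x * z \<in> base_ring)" for x
    by (simp add: ideal_inv_def colon_def)
  note R = submodule_base_ring
  show ?thesis
  proof (rule fract_module.subspaceI)
    show "0 \<in> ideal_inv I"
      unfolding iff using fract_module.subspace_0 [OF R] by (metis mult_zero_left)
    show "x + y \<in> ideal_inv I" if "x \<in> ideal_inv I" "y \<in> ideal_inv I" for x y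
      using that fract_module.subspace_add [OF R] unfolding iff by (metis distrib_right)
    show "to_fract r * x \<in> ideal_inv I" if "x \<in> ideal_inv I" for r x
      using that mult_mem_submodule [OF R] unfolding iff by (metis mult.assoc)
  qed
qed

lemma submodule_v_closure: "submodule (v_closure I)"
  by (simp add: v_closure_def submodule_ideal_inv)

lemma ideal_inv_antimono: "I \<subseteq> J \<Longrightarrow> ideal_inv J \<subseteq> ideal_inv I"
  by (auto simp: ideal_inv_def colon_def)

lemma v_closure_mono: "I \<subseteq> J \<Longrightarrow> v_closure I \<subseteq> v_closure J"
  by (simp add: v_closure_def ideal_inv_antimono)

lemma subset_v_closure: "I \<subseteq> v_closure I"
  by (auto simp: v_closure_def ideal_inv_def colon_def mult.commute)

lemma ideal_inv_v_closure: "ideal_inv (v_closure I) = ideal_inv I"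
  by (metis ideal_inv_antimono subset_antisym subset_v_closure v_closure_def)

lemma v_closure_idem: "v_closure (v_closure I) = v_closure I"
  by (metis ideal_inv_v_closure v_closure_def)

lemma v_closure_base_ring: "v_closure base_ring = (base_ring :: 'a :: idom fract set)"
proof -
  have one: "(1 :: 'a fract) \<in> base_ring"
    by (metis rangeI to_fract_1)
  have "ideal_inv base_ring \<subseteq> (base_ring :: 'a fract set)"
    using one by (metis (mono_tags, lifting) colon_def ideal_inv_def mem_Collect_eq mult_1_right subsetI)
  moreover have "(base_ring :: 'a fract set) \<subseteq> ideal_inv base_ring"
    by (auto simp: ideal_inv_def colon_def simp flip: to_fract_mult)
  ultimately have "ideal_inv base_ring = (base_ring :: 'a fract set)"
    by blast
  then show ?thesis
    by (simp add: v_closure_def)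
qed

lemma v_closure_principal: "c \<noteq> 0 \<Longrightarrow> v_closure (ideal_scale c base_ring) = ideal_scale c base_ring"
  by (simp add: v_closure_scale v_closure_base_ring)

text \<open>A multiplier carries a submodule into \<open>R\<close> as soon as it does so on generators; for two
  generators this turns membership in the \<open>v\<close>-closure into a statement about divisibility.\<close>

lemma mem_v_closure_span_iff:
  "z \<in> v_closure (submodule_span F) \<longleftrightarrow> 
    (\<forall>k. (\<forall>x\<in>F. k * x \<in> base_ring) \<longrightarrow> k * z \<in> base_ring)"
proof -
  have "k \<in> ideal_inv (submodule_span F) \<longleftrightarrow> (\<forall>x\<in>F. k * x \<in> base_ring)" for k
  proof
    assume "k \<in> ideal_inv (submodule_span F)"
    then show "\<forall>x\<in>F. k * x \<in> base_ring"
      by (auto simp: ideal_inv_def colon_def fract_module.span_base)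
  next
    assume *: "\<forall>x\<in>F. k * x \<in> base_ring"
    then have "ideal_scale k (submodule_span F) \<subseteq> base_ring"
      unfolding submodule_span_scale [symmetric]
      using submodule_base_ring
      by (intro fract_module.span_minimal) (auto simp: ideal_scale_def)
    then show "k \<in> ideal_inv (submodule_span F)"
      by (auto simp: ideal_inv_def colon_def ideal_scale_def)
  qed
  then show ?thesis
    by (auto simp: v_closure_def ideal_inv_def [of "ideal_inv _"] colon_def mult.commute)
qed

lemma fin_gen_span: "finite F \<Longrightarrow> fin_gen (submodule_span F)"
  by (auto simp: fin_gen_def)

lemma span_base: "x \<in> F \<Longrightarrow> x \<in> submodule_span F"
  by (rule fract_module.span_base)

lemma span_subset: "F \<subseteq> I \<Longrightarrow> submodule I \<Longrightarrow> submodule_span F \<subseteq> I"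
  by (rule fract_module.span_minimal)

text \<open>The submodule generated by a single \<open>x\<close> is zero if \<open>x = 0\<close>, and only nonzero submodules count in
  the \<open>t\<close>-closure; a second, nonzero generator avoids the case distinction.\<close>

lemma subset_t_closure:
  assumes "submodule I" "I \<noteq> {0}"
  shows "I \<subseteq> t_closure I"
proof
  fix x assume "x \<in> I"
  obtain y where y: "y \<in> I" "y \<noteq> 0"
    using assms fract_module.subspace_0 by auto
  let ?J = "submodule_span {x, y}"
  have xy: "x \<in> ?J" "y \<in> ?J"
    by (simp_all add: span_base)
  have "fin_gen ?J"
    by (simp add: fin_gen_span)
  moreover have "?J \<noteq> {0}"
    using xy y by blast
  moreover have "?J \<subseteq> I"
    using y \<open>x \<in> I\<close> assms by (intro span_subset) auto
  moreover have "x \<in> v_closure ?J"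
    using xy subset_v_closure by blast
  ultimately show "x \<in> t_closure I"
    unfolding t_closure_def by blast
qed

lemma t_closure_subset_v_closure: "t_closure I \<subseteq> v_closure I"
  unfolding t_closure_def by (auto dest: v_closure_mono)

section \<open>Strong greatest common divisors\<close>

text \<open>For \<open>x\<close> and \<open>y\<close> not both zero, \<open>v_gcd g x y\<close> says that \<open>(x, y)\<^sub>v = g R\<close>, with the fractions of
  \<open>(x, y)\<^sup>-\<^sup>1\<close> written as \<open>r / d\<close>.  In a general domain this is stronger than \<open>g\<close> being a greatest
  common divisor, and it is what makes Euclid's lemma hold.\<close>

definition v_gcd :: "'a :: idom \<Rightarrow> 'a \<Rightarrow> 'a \<Rightarrow> bool" where
  "v_gcd g x y \<longleftrightarrow> g dvd x \<and> g dvd y \<and> (\<forall>r d. d dvd r * x \<and> d dvd r * y \<longrightarrow> d dvd r * g)"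

abbreviation v_coprime :: "'a :: idom \<Rightarrow> 'a \<Rightarrow> bool" where
  "v_coprime \<equiv> v_gcd 1"

lemma v_coprime_iff: "v_coprime x y \<longleftrightarrow> (\<forall>r d. d dvd r * x \<and> d dvd r * y \<longrightarrow> d dvd r)"
  by (simp add: v_gcd_def)

lemma v_gcd_sym: "v_gcd g x y \<Longrightarrow> v_gcd g y x"
  unfolding v_gcd_def by blast

lemma v_gcd_dvd: "v_gcd g x y \<Longrightarrow> g dvd x" "v_gcd g x y \<Longrightarrow> g dvd y"
  by (simp_all add: v_gcd_def)

lemma v_gcd_greatest: "v_gcd g x y \<Longrightarrow> d dvd x \<Longrightarrow> d dvd y \<Longrightarrow> d dvd g"
  unfolding v_gcd_def by (elim conjE allE [of _ 1] allE [of _ d]) simp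

lemma v_gcd_unit_imp_v_coprime:
  assumes "v_gcd g x y" "g dvd 1"
  shows "v_coprime x y"
  unfolding v_coprime_iff
proof (intro allI impI)
  fix r d assume "d dvd r * x \<and> d dvd r * y"
  then have "d dvd r * g"
    using assms(1) by (simp add: v_gcd_def)
  also have "r * g dvd r * 1"
    using assms(2) by (intro mult_dvd_mono) simp_all
  finally show "d dvd r"
    by simp
qed

lemma v_gcd_mult: "v_gcd g x y \<Longrightarrow> v_gcd (s * g) (s * x) (s * y)"
  unfolding v_gcd_def
proof (elim conjE, intro conjI allI impI)
  fix r d
  assume *: "\<forall>r d. d dvd r * x \<and> d dvd r * y \<longrightarrow> d dvd r * g"
    and "d dvd r * (s * x) \<and> d dvd r * (s * y)"
  then show "d dvd r * (s * g)"
    using *[rule_format, of d "r * s"] by (simp add: mult.assoc)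
qed (simp_all add: mult_dvd_mono)

lemma v_coprime_dvd_right: "v_coprime x y \<Longrightarrow> z dvd y \<Longrightarrow> v_coprime x z"
  unfolding v_coprime_iff
proof (intro allI impI)
  fix r d
  assume "\<forall>r d. d dvd r * x \<and> d dvd r * y \<longrightarrow> d dvd r" "z dvd y" "d dvd r * x \<and> d dvd r * z"
  moreover from this have "d dvd r * y"
    using dvd_trans [OF _ mult_dvd_mono [OF dvd_refl]] by blast
  ultimately show "d dvd r"
    by blast
qed

lemma v_coprime_dvd_both: "v_coprime x y \<Longrightarrow> w dvd x \<Longrightarrow> z dvd y \<Longrightarrow> v_coprime w z"
  by (rule v_gcd_sym [OF v_coprime_dvd_right [OF v_gcd_sym [OF v_coprime_dvd_right]]])

lemma v_coprime_mult_right: "v_coprime x y \<Longrightarrow> v_coprime x z \<Longrightarrow> v_coprime x (y * z)"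
  unfolding v_coprime_iff
proof (intro allI impI)
  fix r d
  assume y: "\<forall>r d. d dvd r * x \<and> d dvd r * y \<longrightarrow> d dvd r"
    and z: "\<forall>r d. d dvd r * x \<and> d dvd r * z \<longrightarrow> d dvd r"
    and d: "d dvd r * x \<and> d dvd r * (y * z)"
  have "d dvd (r * z) * x" "d dvd (r * z) * y"
    using d dvd_mult [of d "r * x" z] by (auto simp: mult_ac)
  then show "d dvd r"
    using y [rule_format, of d "r * z"] z [rule_format, of d r] d by blast
qed

text \<open>Euclid's lemma is the defining property with multiplier \<open>z\<close>: \<open>x\<close> divides both \<open>z x\<close> and \<open>z y\<close>.\<close>

lemma v_coprime_dvd_mult: "v_coprime x y \<Longrightarrow> x dvd y * z \<Longrightarrow> x dvd z"
  unfolding v_coprime_iff by (elim allE [of _ z] allE [of _ x]) (simp add: mult.commute)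

lemma v_coprime_mult_dvd:
  assumes "v_coprime x y" "x dvd a" "y dvd a"
  shows "x * y dvd a"
proof -
  obtain k where k: "a = x * k"
    using assms by blast
  have "y dvd k"
    using assms(3) unfolding k by (rule v_coprime_dvd_mult [OF v_gcd_sym [OF assms(1)]])
  then show ?thesis
    by (simp add: k mult_dvd_mono)
qed

lemma v_coprime_dvd_imp_unit: "v_coprime x y \<Longrightarrow> x dvd y \<Longrightarrow> x dvd 1"
  by (rule v_gcd_greatest [of 1 x y x]) simp_all

lemma Fract_mult_mem_base_ring_iff:
  assumes "d \<noteq> 0"
  shows "Fract r d * to_fract z \<in> base_ring \<longleftrightarrow> d dvd r * z"
proof -
  have "Fract r d * to_fract z = to_fract t \<longleftrightarrow> r * z = d * t" for t
    using assms by (simp add: to_fract_def eq_fract mult.commute)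
  then show ?thesis
    by (simp add: image_iff dvd_def)
qed

lemma v_gcd_mem_v_closure:
  assumes "v_gcd g x y" 
  shows "to_fract g \<in> v_closure (submodule_span {to_fract x, to_fract y})"
  unfolding mem_v_closure_span_iff
proof (intro allI impI)
  fix k assume k: "\<forall>z\<in>{to_fract x, to_fract y}. k * z \<in> base_ring"
  obtain r d where rd: "k = Fract r d" "d \<noteq> 0"
    by (cases k) auto
  have "d dvd r * x" "d dvd r * y"
    using k rd(2) by (simp_all add: rd(1) Fract_mult_mem_base_ring_iff del: image_iff)
  then have "d dvd r * g"
    using assms unfolding v_gcd_def by blast
  then show "k * to_fract g \<in> base_ring"
    using rd(2) by (simp add: rd(1) Fract_mult_mem_base_ring_iff del: image_iff)
qed

lemma principal_v_closure_imp_v_gcd: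
  assumes "v_closure (submodule_span {to_fract x, to_fract y}) = ideal_scale (to_fract g) base_ring"
    and "x \<noteq> 0 \<or> y \<noteq> 0"
  shows "v_gcd g x y"
  unfolding v_gcd_def
proof (intro conjI allI impI)
  let ?J = "v_closure (submodule_span {to_fract x, to_fract y})"
  have "to_fract x \<in> ?J" "to_fract y \<in> ?J"
    by (auto intro!: span_base subsetD [OF subset_v_closure])
  then show "g dvd x" "g dvd y"
    using assms by (simp_all add: to_fract_mem_principal_iff)
  fix r d assume rd: "d dvd r * x \<and> d dvd r * y"
  show "d dvd r * g"
  proof (cases "d = 0")
    case True
    with rd assms(2) show ?thesis by auto
  next
    case False
    note * = Fract_mult_mem_base_ring_iff [OF False]
    have "to_fract g \<in> ?J"
      by (simp add: assms to_fract_mem_principal_iff)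
    moreover have "Fract r d * z \<in> base_ring" if "z \<in> {to_fract x, to_fract y}" for z
      using that rd * [of r x] * [of r y] by blast
    ultimately have "Fract r d * to_fract g \<in> base_ring"
      unfolding mem_v_closure_span_iff by blast
    then show ?thesis
      by (simp add: *)
  qed
qed

section \<open>The GCD property\<close>

lemma t_ideal_v_closure:
  assumes "fractional_ideal (v_closure I)" "v_closure I \<noteq> {0}"
  shows "t_ideal (v_closure I)"
proof -
  have "t_closure (v_closure I) = v_closure I"
    using subset_t_closure [OF submodule_v_closure assms(2)]
      t_closure_subset_v_closure [of "v_closure I"] by (simp add: v_closure_idem subset_antisym)
  with assms show ?thesis
    by (simp add: t_ideal_def)
qed

text \<open>The class of \<open>J\<close> is idempotent and \<open>(J : J) = R\<close>, which says that \<open>J\<close> is \<open>v\<close>-invertible; an invertible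
  idempotent is the identity, here the class of principal ideals.  Concretely, \<open>J J \<subseteq> c J\<close> means that
  \<open>c\<^sup>-\<^sup>1 J\<close> is contained in \<open>(J : J) = R\<close>.  Conversely, if \<open>y \<in> J\<^sup>-\<^sup>1\<close> then
  \<open>y c J = y (J\<^sup>2)\<^sub>t \<subseteq> (y J J)\<^sub>v \<subseteq> J\<^sub>v = J\<close>, so that \<open>y c \<in> (J : J) = R\<close>; this shows \<open>c \<in> J\<^sub>v = J\<close>.\<close>

lemma idempotent_t_class_imp_principal:
  fixes J :: "'a :: idom fract set"
  assumes div: "v_closure J = J" and colon: "colon J J = base_ring"
    and c: "c \<noteq> 0" "t_closure (ideal_mult J J) = ideal_scale c J"
    and nz: "J \<noteq> {0}"
  shows "J = ideal_scale c base_ring"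
proof
  let ?P = "ideal_mult J J"
  have J: "submodule J"
    using submodule_v_closure [of J] by (simp add: div)
  have "?P \<noteq> {0}"
  proof -
    obtain j where "j \<in> J" "j \<noteq> 0"
      using nz J fract_module.subspace_0 by auto
    then have "j * j \<in> ?P" "j * j \<noteq> 0"
      unfolding ideal_mult_def by (auto intro: span_base)
    then show ?thesis
      by blast
  qed
  moreover have "submodule ?P"
    by (simp add: ideal_mult_def)
  ultimately have P: "?P \<subseteq> ideal_scale c J"
    using subset_t_closure c(2) by blast
  show "J \<subseteq> ideal_scale c base_ring"
  proof
    fix x assume x: "x \<in> J"
    have "inverse c * x * j \<in> J" if j: "j \<in> J" for j
    proof -
      have "x * j \<in> ?P"
        unfolding ideal_mult_def using x j by (auto intro: span_base)
      then obtain i where "x * j = c * i" "i \<in> J"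
        using P by (auto simp: ideal_scale_def)
      then show ?thesis
        using c(1) by (simp add: mult.assoc [of "inverse c"]) (simp flip: mult.assoc)
    qed
    then have "inverse c * x \<in> base_ring"
      unfolding colon [symmetric] by (simp add: colon_def)
    then have "c * (inverse c * x) \<in> ideal_scale c base_ring"
      unfolding ideal_scale_def by (rule imageI)
    then show "x \<in> ideal_scale c base_ring"
      using c(1) by (simp flip: mult.assoc)
  qed
  have "c * y \<in> base_ring" if y: "y \<in> ideal_inv J" for y
  proof -
    have "ideal_scale y ?P \<subseteq> J"
      unfolding ideal_mult_def submodule_span_scale [symmetric]
    proof (rule span_subset [OF _ J], clarsimp simp: ideal_scale_def)
      fix a b assume "a \<in> J" "b \<in> J"
      then obtain r where "y * a = to_fract r"
        using y by (auto simp: ideal_inv_def colon_def)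
      then have eq: "y * (a * b) = to_fract r * b"
        by (simp flip: mult.assoc)
      show "y * (a * b) \<in> J"
        unfolding eq using J \<open>b \<in> J\<close> by (rule mult_mem_submodule)
    qed
    have "c * y * j \<in> J" if j: "j \<in> J" for j
    proof (cases "y = 0")
      case True
      then show ?thesis
        using J fract_module.subspace_0 by auto
    next
      case False
      have "c * j \<in> v_closure ?P"
        using j c(2) t_closure_subset_v_closure [of ?P] by (auto simp: ideal_scale_def)
      then have "y * (c * j) \<in> v_closure (ideal_scale y ?P)"
        using v_closure_scale [OF False] by (auto simp: ideal_scale_def)
      also have "\<dots> \<subseteq> J"
        using v_closure_mono [OF \<open>ideal_scale y ?P \<subseteq> J\<close>] by (simp add: div)
      finally show ?thesis
        by (simp add: mult_ac)
    qed
    then show ?thesis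
      unfolding colon [symmetric] by (simp add: colon_def)
  qed
  then have "c \<in> v_closure J"
    by (simp add: v_closure_def ideal_inv_def [of "ideal_inv _"] colon_def)
  then have "c \<in> J"
    by (simp add: div)
  then show "ideal_scale c base_ring \<subseteq> J"
    using mult_mem_submodule [OF J] by (auto simp: ideal_scale_def mult.commute)
qed

proposition v_gcd_exists:
  fixes x y :: "'a :: idom"
  assumes v: "v_domain TYPE('a)" and b: "boole_t_regular TYPE('a)"
    and nz: "x \<noteq> 0 \<or> y \<noteq> 0"
  obtains g where "v_gcd g x y"
proof -
  let ?I = "submodule_span {to_fract x, to_fract y}"
  let ?J = "v_closure ?I"
  have xy: "to_fract x \<in> ?I" "to_fract y \<in> ?I"
    by (simp_all add: span_base)
  have "?I \<subseteq> base_ring"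
    by (rule span_subset [OF _ submodule_base_ring]) auto
  then have R: "?J \<subseteq> base_ring"
    using v_closure_mono v_closure_base_ring by blast
  have "?I \<noteq> {0}" 
    using xy nz by (metis singletonD to_fract_eq_0_iff)
  then have J0: "?J \<noteq> {0}"
    using subset_v_closure xy nz by (metis singletonD subsetD to_fract_eq_0_iff)
  have "colon ?J ?J = base_ring"
    using v \<open>?I \<noteq> {0}\<close> \<open>?I \<subseteq> base_ring\<close> by (simp add: v_domain_def fin_gen_span)
  moreover have "fractional_ideal ?J"
    unfolding fractional_ideal_def using R submodule_v_closure
    by (intro conjI exI [of _ 1]) auto
  then have "t_ideal ?J"
    using J0 by (rule t_ideal_v_closure)
  then obtain c where "c \<noteq> 0" "t_closure (ideal_mult ?J ?J) = ideal_scale c ?J"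
    using b by (auto simp: boole_t_regular_iff)
  ultimately have J: "?J = ideal_scale c base_ring"
    using J0 by (intro idempotent_t_class_imp_principal) (simp_all add: v_closure_idem)
  have "c \<in> ideal_scale c base_ring"
    by (metis mem_principal_iff mult_1_right to_fract_1)
  then have "c \<in> base_ring"
    using J R by (metis subsetD)
  then obtain g where g: "c = to_fract g"
    by (rule imageE)
  show thesis
    by (rule that [OF principal_v_closure_imp_v_gcd [OF J [unfolded g] nz]])
qed

section \<open>Directed unions of principal ideals and t-maximal ideals\<close>

text \<open>A finitely generated submodule of a directed union lies in one of the principal ideals, which
  is divisorial and so contains its \<open>v\<close>-closure.  The element \<open>e\<close> is a common denominator.\<close>

lemma t_ideal_directed_union:
  fixes D :: "'a :: idom fract set"
  assumes ne: "D \<noteq> {}" and nz: "0 \<notin> D"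
    and dir: "\<And>x y. x \<in> D \<Longrightarrow> y \<in> D \<Longrightarrow>
      \<exists>z\<in>D. x \<in> ideal_scale z base_ring \<and> y \<in> ideal_scale z base_ring"
    and den: "e \<noteq> 0" "\<And>x. x \<in> D \<Longrightarrow> to_fract e * x \<in> base_ring"
  shows "t_ideal (\<Union>d\<in>D. ideal_scale d base_ring)"
proof -
  let ?I = "\<Union>d\<in>D. ideal_scale d base_ring"
  have sub: "ideal_scale x base_ring \<subseteq> ideal_scale z base_ring"
    if "x \<in> ideal_scale z base_ring" for x z :: "'a fract"
  proof
    fix w assume "w \<in> ideal_scale x base_ring"
    with that obtain r t where "x = z * to_fract r" "w = x * to_fract t"
      unfolding mem_principal_iff by blast
    then have "w = z * to_fract (r * t)"
      by (simp add: mult.assoc)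
    then show "w \<in> ideal_scale z base_ring"
      unfolding mem_principal_iff by (rule exI)
  qed
  have dir': "\<exists>z\<in>D. x \<in> ideal_scale z base_ring \<and> y \<in> ideal_scale z base_ring"
    if "x \<in> ?I" "y \<in> ?I" for x y
  proof -
    obtain x' y' where x: "x' \<in> D" "x \<in> ideal_scale x' base_ring"
      and y: "y' \<in> D" "y \<in> ideal_scale y' base_ring"
      using \<open>x \<in> ?I\<close> \<open>y \<in> ?I\<close> by (elim UN_E) (rule that)
    obtain z where "z \<in> D" "x' \<in> ideal_scale z base_ring" "y' \<in> ideal_scale z base_ring"
      using dir [OF x(1) y(1)] by (elim bexE conjE) (rule that)
    then show ?thesis
      using x(2) y(2) sub by (intro bexI [of _ z] conjI) (meson subsetD)+
  qed
  have D: "d \<in> ideal_scale d base_ring" for d :: "'a fract"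
    by (metis mem_principal_iff mult_1_right to_fract_1)
  have mod: "submodule (ideal_scale d base_ring)" for d :: "'a fract"
    by (simp add: submodule_scale submodule_base_ring)
  have sI: "submodule ?I"
  proof (rule fract_module.subspaceI)
    show "0 \<in> ?I"
      using ne mod fract_module.subspace_0 by auto
    show "x + y \<in> ?I" if xy: "x \<in> ?I" "y \<in> ?I" for x y
      using dir' [OF xy] mod fract_module.subspace_add by blast
    show "to_fract r * x \<in> ?I" if "x \<in> ?I" for r x
      using that mult_mem_submodule [OF mod] by blast
  qed
  have fin: "\<exists>d\<in>D. F \<subseteq> ideal_scale d base_ring" if "finite F" "F \<subseteq> ?I" for F
    using that
  proof (induction F)
    case empty
    with ne show ?case by blast
  next
    case (insert x F)
    then obtain d where "d \<in> D" "F \<subseteq> ideal_scale d base_ring"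
      by auto
    moreover have "x \<in> ?I" "d \<in> ?I"
      using insert.prems \<open>d \<in> D\<close> D by auto
    then obtain z where "z \<in> D" "x \<in> ideal_scale z base_ring" "d \<in> ideal_scale z base_ring"
      using dir' by blast
    ultimately show ?case
      using sub by blast
  qed
  have I0: "?I \<noteq> {0}"
  proof -
    obtain d where "d \<in> D"
      using ne by blast
    then have "d \<in> ?I" "d \<noteq> 0"
      using D nz by auto
    then show ?thesis
      by blast
  qed
  have "t_closure ?I \<subseteq> ?I"
  proof
    fix x assume "x \<in> t_closure ?I"
    then obtain F where F: "finite F" "submodule_span F \<subseteq> ?I" "x \<in> v_closure (submodule_span F)"
      by (auto simp: t_closure_def fin_gen_def)
    from F(2) have "F \<subseteq> ?I"
      by (rule subset_trans [rotated]) (rule subsetI, rule span_base)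
    with fin F(1) obtain d where d: "d \<in> D" "F \<subseteq> ideal_scale d base_ring"
      by blast
    have "v_closure (submodule_span F) \<subseteq> v_closure (ideal_scale d base_ring)"
      by (intro v_closure_mono span_subset d mod)
    also have "\<dots> = ideal_scale d base_ring"
      using d nz by (intro v_closure_principal) auto
    finally show "x \<in> ?I"
      using F d by blast
  qed
  moreover have "fractional_ideal ?I"
    unfolding fractional_ideal_def
  proof (intro conjI sI exI [of _ e] den(1) ballI)
    fix x assume "x \<in> ?I"
    then obtain d r where "d \<in> D" "x = d * to_fract r"
      by (auto simp: mem_principal_iff)
    moreover from this obtain s where "to_fract e * d = to_fract s"
      using den(2) by blast
    ultimately have "to_fract e * x = to_fract (s * r)"
      by (simp flip: mult.assoc)
    then show "to_fract e * x \<in> base_ring"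
      by (rule range_eqI)
  qed
  ultimately show ?thesis
    using subset_t_closure [OF sI I0] I0 unfolding t_ideal_def by blast
qed

lemma t_ideal_v_gcd_mem:
  assumes "t_ideal I" "to_fract x \<in> I" "to_fract y \<in> I" "x \<noteq> 0 \<or> y \<noteq> 0" "v_gcd g x y"
  shows "to_fract g \<in> I"
proof -
  let ?J = "submodule_span {to_fract x, to_fract y}"
  have "?J \<noteq> {0}"
    using assms(4) span_base [of _ "{to_fract x, to_fract y}"]
    by (metis insertCI singletonD to_fract_eq_0_iff)
  moreover have "?J \<subseteq> I"
    using assms by (intro span_subset) (auto simp: t_ideal_def fractional_ideal_def)
  ultimately have "v_closure ?J \<subseteq> t_closure I"
    unfolding t_closure_def
    by (intro Union_upper CollectI exI [of _ ?J] conjI refl) (simp_all add: fin_gen_span)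
  then show ?thesis
    using v_gcd_mem_v_closure [OF assms(5)] assms(1) unfolding t_ideal_def by (metis subsetD)
qed

lemma t_ideal_dvd_mem:
  assumes "t_ideal I" "to_fract x \<in> I" "x dvd y" 
  shows "to_fract y \<in> I"
  using assms mult_mem_submodule [of I "to_fract x"]
  by (auto simp: t_ideal_def fractional_ideal_def mult.commute elim!: dvdE)

lemma t_maximal_t_ideal: "t_maximal M \<Longrightarrow> t_ideal M"
  by (simp add: t_maximal_def)

lemma t_maximal_no_unit:
  assumes "t_maximal M" "to_fract u \<in> M"
  shows "\<not> u dvd 1"
proof
  assume "u dvd 1"
  then have "to_fract x \<in> M" for x
    using assms t_ideal_dvd_mem t_maximal_t_ideal by (metis dvd_trans one_dvd)
  then show False
    using assms by (auto simp: t_maximal_def)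
qed

lemma t_ideal_nonzero_mem:
  assumes "t_ideal M" "M \<subseteq> base_ring"
  obtains m where "m \<noteq> 0" "to_fract m \<in> M"
proof -
  obtain z where "z \<in> M" "z \<noteq> 0"
    using assms fract_module.subspace_0
    by (auto simp: t_ideal_def fractional_ideal_def)
  then show ?thesis
    using assms(2) that by (auto simp: image_iff)
qed

text \<open>The greatest common divisors of \<open>u\<close> with the nonzero elements of \<open>N\<close> generate a \<open>t\<close>-ideal that
  contains \<open>N\<close> and \<open>u\<close>.  By maximality it contains \<open>1\<close>, so one of them is a unit.\<close>

lemma t_maximal_v_coprime:
  fixes N :: "'a :: idom fract set"
  assumes ex: "\<And>x y :: 'a. x \<noteq> 0 \<or> y \<noteq> 0 \<Longrightarrow> \<exists>g. v_gcd g x y"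
    and N: "t_maximal N" and u: "to_fract u \<notin> N"
  obtains w where "w \<noteq> 0" "to_fract w \<in> N" "v_coprime u w"
proof -
  let ?E = "{g. \<exists>w. w \<noteq> 0 \<and> to_fract w \<in> N \<and> v_gcd g u w}"
  let ?I = "\<Union>d\<in>to_fract ` ?E. ideal_scale d base_ring"
  have tN: "t_ideal N" and NR: "N \<subset> base_ring"
    using N by (auto simp: t_maximal_def)
  obtain m where m: "m \<noteq> 0" "to_fract m \<in> N"
    using t_ideal_nonzero_mem tN NR by blast
  then obtain h where h: "v_gcd h u m"
    using ex by blast
  have "t_ideal ?I"
  proof (rule t_ideal_directed_union)
    show "to_fract ` ?E \<noteq> {}"
      using m h by blast
    show "0 \<notin> to_fract ` ?E"
      by (auto simp: image_iff v_gcd_def)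
    show "(1 :: 'a) \<noteq> 0"
      by simp
    show "to_fract 1 * x \<in> base_ring" if "x \<in> to_fract ` ?E" for x
      using that by auto
    fix x y assume "x \<in> to_fract ` ?E" "y \<in> to_fract ` ?E"
    then obtain g1 g2 w1 w2 where xy: "x = to_fract g1" "y = to_fract g2"
      and w: "w1 \<noteq> 0" "w2 \<noteq> 0" "to_fract w1 \<in> N" "to_fract w2 \<in> N"
      and g: "v_gcd g1 u w1" "v_gcd g2 u w2"
      by blast
    obtain w3 where w3: "v_gcd w3 w1 w2"
      using ex w by blast
    then have w3': "to_fract w3 \<in> N" "w3 \<noteq> 0"
      using t_ideal_v_gcd_mem tN w by (auto simp: v_gcd_def)
    then obtain g3 where g3: "v_gcd g3 u w3"
      using ex by blast
    have "g3 dvd g1" "g3 dvd g2"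
      using v_gcd_greatest [OF g(1)] v_gcd_greatest [OF g(2)] v_gcd_dvd [OF g3]
        dvd_trans [OF v_gcd_dvd(2) [OF g3]] v_gcd_dvd [OF w3] by blast+
    then show "\<exists>z\<in>to_fract ` ?E. x \<in> ideal_scale z base_ring \<and> y \<in> ideal_scale z base_ring"
      using g3 w3' xy by (intro bexI [of _ "to_fract g3"]) (auto simp: to_fract_mem_principal_iff)
  qed
  have mem: "to_fract x \<in> ?I" if "w \<noteq> 0" "to_fract w \<in> N" "v_gcd g u w" "g dvd x" for g w x
    using that
    by (intro UN_I [of "to_fract g"] imageI CollectI exI [of _ w])
       (simp_all add: to_fract_mem_principal_iff)
  have "N \<subseteq> ?I"
  proof
    fix z assume z: "z \<in> N"
    show "z \<in> ?I"
    proof (cases "z = 0")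
      case True
      then show ?thesis
        using mem [OF m h dvd_0_right] by simp
    next
      case False
      then obtain w where w: "z = to_fract w" "w \<noteq> 0"
        using z NR by auto
      then obtain g where g: "v_gcd g u w"
        using ex by blast
      show ?thesis
        using z unfolding w(1) by (intro mem [OF w(2) _ g v_gcd_dvd(2) [OF g]])
    qed
  qed
  moreover have "to_fract u \<in> ?I"
    by (rule mem [OF m h v_gcd_dvd(1) [OF h]])
  moreover have "?I \<subseteq> base_ring"
    by (auto simp: mem_principal_iff simp flip: to_fract_mult)
  ultimately have "?I = base_ring"
    using N u \<open>t_ideal ?I\<close> unfolding t_maximal_def by blast
  then have "to_fract 1 \<in> ?I"
    by (simp only: rangeI)
  then obtain g w where g: "w \<noteq> 0" "to_fract w \<in> N" "v_gcd g u w" "g dvd 1"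
    by (auto simp: to_fract_mem_principal_iff simp del: to_fract_1)
  show thesis
    by (rule that [OF g(1,2) v_gcd_unit_imp_v_coprime [OF g(3,4)]])
qed

section \<open>Finite character\<close>

text \<open>The inductive step towards an infinite sequence of coprime factors.  What must survive is that
  infinitely many \<open>t\<close>-maximal ideals containing \<open>a\<close> avoid the product \<open>s\<close> found so far.  Two of these
  ideals supply coprime candidates \<open>u\<close> and \<open>w\<close> for the next factor.  An ideal that avoids \<open>s\<close> cannot
  contain both \<open>s u\<close> and \<open>s w\<close>, whose greatest common divisor is \<open>s\<close>; hence infinitely many ideals
  avoid at least one of the two products, and that candidate is kept.\<close>

lemma split_coprime_factor:
  fixes a s :: "'a :: idom"
  assumes ex: "\<And>x y :: 'a. x \<noteq> 0 \<or> y \<noteq> 0 \<Longrightarrow> \<exists>g. v_gcd g x y"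
    and a: "a \<noteq> 0" "s dvd a"
    and inf: "infinite {M. t_maximal M \<and> to_fract a \<in> M \<and> to_fract s \<notin> M}"
  obtains u where "\<not> u dvd 1" "v_coprime u s" "s * u dvd a"
    "infinite {M. t_maximal M \<and> to_fract a \<in> M \<and> to_fract (s * u) \<notin> M}"
proof -
  let ?W = "\<lambda>s. {M. t_maximal M \<and> to_fract a \<in> M \<and> to_fract s \<notin> M}"
  obtain M where M: "M \<in> ?W s"
    using inf by (metis (lifting) equals0I finite.emptyI)
  obtain N where N: "N \<in> ?W s" "N \<noteq> M"
    using inf by (metis (lifting) finite.emptyI finite.insertI finite_subset insertI1 subsetI)
  have "\<not> N \<subseteq> M"
    using M N unfolding t_maximal_def by blast
  then obtain n where n: "to_fract n \<in> N" "to_fract n \<notin> M"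
    using N by (auto simp: t_maximal_def)
  obtain m where m: "m \<noteq> 0" "to_fract m \<in> M" "v_coprime n m"
    using M n t_maximal_v_coprime [OF ex] by blast
  \<comment> \<open>An element of such an ideal can be replaced, within the ideal, by a divisor of it that also
     divides \<open>a\<close> and is coprime to \<open>s\<close>.\<close>
  have factor: "\<exists>u. to_fract u \<in> L \<and> v_coprime u s \<and> u dvd a \<and> u dvd l"
    if L: "L \<in> ?W s" "to_fract l \<in> L" for L l
  proof -
    have tL: "t_ideal L"
      using L by (simp add: t_maximal_t_ideal)
    obtain k where k: "k \<noteq> 0" "to_fract k \<in> L" "v_coprime s k"
      using L t_maximal_v_coprime [OF ex] by blast
    obtain g where g: "v_gcd g k l"
      using ex k by blast
    obtain u where u: "v_gcd u a g"
      using ex a by blast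
    have "to_fract u \<in> L"
      using t_ideal_v_gcd_mem [OF tL] k L g u a by blast
    moreover have "v_coprime u s"
    proof -
      have "u dvd k"
        using dvd_trans [OF v_gcd_dvd(2) [OF u]] v_gcd_dvd [OF g] by blast
      then show ?thesis
        using v_coprime_dvd_right [OF k(3)] by (blast intro: v_gcd_sym)
    qed
    moreover have "u dvd l"
      using dvd_trans [OF v_gcd_dvd(2) [OF u]] v_gcd_dvd [OF g] by blast
    ultimately show ?thesis
      using v_gcd_dvd [OF u] by blast
  qed
  obtain u where u: "to_fract u \<in> M" "v_coprime u s" "u dvd a" "u dvd m"
    using factor M m by blast
  obtain w where w: "to_fract w \<in> N" "v_coprime w s" "w dvd a" "w dvd n"
    using factor N n by blast
  have "v_coprime u w"
    using v_coprime_dvd_both [OF m(3) w(4) u(4)] by (blast intro: v_gcd_sym)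
  then have sgcd: "v_gcd s (s * u) (s * w)"
    using v_gcd_mult by fastforce
  have dvd: "s * u dvd a" "s * w dvd a"
    using v_coprime_mult_dvd [OF u(2,3) a(2)] v_coprime_mult_dvd [OF w(2,3) a(2)]
    by (simp_all add: mult.commute)
  then have "s * u \<noteq> 0"
    using a(1) by auto
  then have "?W s \<subseteq> ?W (s * u) \<union> ?W (s * w)"
    using sgcd t_ideal_v_gcd_mem t_maximal_t_ideal by blast
  then have "infinite (?W (s * u)) \<or> infinite (?W (s * w))"
    using inf finite_subset by blast
  moreover have "\<not> u dvd 1" "\<not> w dvd 1"
    using u w M N t_maximal_no_unit by blast+
  ultimately show thesis
    using that dvd u(2) w(2) by blast
qed

lemma infinite_coprime_factors:
  fixes a :: "'a :: idom"
  assumes ex: "\<And>x y :: 'a. x \<noteq> 0 \<or> y \<noteq> 0 \<Longrightarrow> \<exists>g. v_gcd g x y"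
    and a: "a \<noteq> 0"
    and inf: "infinite {M. t_maximal M \<and> to_fract a \<in> M}"
  obtains s u where "\<And>n. s n dvd a" "\<And>n. s (Suc n) = s n * u n"
    "\<And>n. v_coprime (u n) (s n)" "\<And>n. \<not> u n dvd 1"
proof -
  let ?W = "\<lambda>s. {M. t_maximal M \<and> to_fract a \<in> M \<and> to_fract s \<notin> M}"
  let ?Q = "\<lambda>s t. \<exists>u. t = s * u \<and> v_coprime u s \<and> \<not> u dvd 1"
  have "\<exists>s. \<forall>n. (s n dvd a \<and> infinite (?W (s n))) \<and> ?Q (s n) (s (Suc n))"
  proof (rule dependent_nat_choice)
    have "?W 1 = {M. t_maximal M \<and> to_fract a \<in> M}"
      using t_maximal_no_unit [of _ 1] by auto
    then have "1 dvd a \<and> infinite (?W 1)"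
      using inf by simp
    then show "\<exists>s. s dvd a \<and> infinite (?W s)"
      by (rule exI)
    show "\<exists>t. (t dvd a \<and> infinite (?W t)) \<and> ?Q s t" 
      if s: "s dvd a \<and> infinite (?W s)" for s and n :: nat
    proof -
      obtain u where "\<not> u dvd 1" "v_coprime u s" "s * u dvd a" "infinite (?W (s * u))"
        by (rule split_coprime_factor [OF ex a s [THEN conjunct1] s [THEN conjunct2]])
      then show ?thesis
        by (intro exI [of _ "s * u"] exI [of _ u] conjI refl)
    qed
  qed
  then obtain s where s: "\<And>n. s n dvd a" "\<And>n. ?Q (s n) (s (Suc n))"
    by blast
  from s(2) obtain u where 
    "\<And>n. s (Suc n) = s n * u n \<and> v_coprime (u n) (s n) \<and> \<not> u n dvd 1"
    by metis
  with s(1) that show thesis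
    by blast
qed

lemma to_fract_power: "to_fract (q ^ k) = to_fract q ^ k"
  by (induction k) simp_all

text \<open>The union of the ideals \<open>(a / s\<^sub>n) R\<close> has no idempotent class.  Additively, in the group of
  divisibility, \<open>(I\<^sup>2)\<^sub>t = c I\<close> would bound \<open>a - c\<close> above by \<open>2 s\<^sub>m\<close> for some \<open>m\<close>, and below by
  \<open>2 s\<^sub>n - s\<^sub>p\<close> for every \<open>n\<close> and a suitable \<open>p\<close>; with \<open>n = m + 1\<close> the component of \<open>u\<^sub>m\<close> gives the
  contradiction.\<close>

lemma infinite_coprime_factors_not_boole:
  fixes a :: "'a :: idom"
  assumes a: "a \<noteq> 0"
    and s: "\<And>n. s n dvd a" "\<And>n. s (Suc n) = s n * u n"
    and u: "\<And>n. v_coprime (u n) (s n)" "\<And>n. \<not> u n dvd 1"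
  shows "\<not> boole_t_regular TYPE('a)"
proof
  assume boole: "boole_t_regular TYPE('a)"
  have s0: "s n \<noteq> 0" for n
    using s(1) a by (metis dvd_0_left)
  have mono: "s m dvd s n" if "m \<le> n" for m n
    using that by (induction rule: dec_induct) (auto simp: s(2))
  define b where "b n = to_fract a / to_fract (s n)" for n
  have b0: "b n \<noteq> 0" for n
    using a s0 by (simp add: b_def)
  \<comment> \<open>\<open>I 1\<close> is the test ideal and \<open>I 2\<close> its square; both are \<open>t\<close>-ideals by the same argument.\<close>
  define D where "D k = range (\<lambda>n. b n ^ k)" for k
  define I where "I k = (\<Union>d\<in>D k. ideal_scale d base_ring)" for k
  have chain: "b m ^ k \<in>
      ideal_scale (b n ^ k) base_ring" if mn: "m \<le> n" for m n k
  proof -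
    obtain q where "s n = s m * q"
      using mono [OF mn] by blast
    then have "b m = b n * to_fract q"
      using s0 [of n] by (simp add: b_def)
    then show ?thesis
      unfolding mem_principal_iff
      by (intro exI [of _ "q ^ k"]) (simp only: power_mult_distrib to_fract_power)
  qed
  have mem: "z \<in> I k \<longleftrightarrow> (\<exists>n r. z = b n ^ k * to_fract r)" for z k
    by (auto simp: I_def D_def mem_principal_iff)
  have memI: "b n ^ k * to_fract r \<in> I k" for n k r
    unfolding mem by blast
  have tI: "t_ideal (I k)" for k
    unfolding I_def
  proof (rule t_ideal_directed_union)
    show "D k \<noteq> {}" "0 \<notin> D k"
      using b0 by (auto simp: D_def)
    show "(1 :: 'a) \<noteq> 0"
      by simp
    show "to_fract 1 * x \<in> base_ring" if "x \<in> D k" for x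
    proof -
      obtain n where x: "x = b n ^ k"
        using \<open>x \<in> D k\<close> by (auto simp: D_def)
      obtain q where "a = s n * q"
        using s(1) by blast
      then have "b n = to_fract q"
        using s0 [of n] by (simp add: b_def)
      then have "to_fract 1 * x = to_fract (q ^ k)"
        unfolding x by (simp add: to_fract_power)
      then show ?thesis
        by (rule range_eqI)
    qed
    fix x y assume "x \<in> D k" "y \<in> D k"
    then obtain m n where "x = b m ^ k"
        "y = b n ^ k"
      by (auto simp: D_def)
    then show "\<exists>z\<in>D k. x \<in> ideal_scale z base_ring \<and> y \<in> ideal_scale z base_ring"
      using chain [of m "max m n" k] chain [of n "max m n" k] by (auto simp: D_def)
  qed
  have sq: "ideal_mult (I 1) (I 1) = I 2"
  proof
    have "submodule (I 2)"
      using tI by (simp add: t_ideal_def fractional_ideal_def)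
    then show "ideal_mult (I 1) (I 1) \<subseteq> I 2"
      unfolding ideal_mult_def
    proof (rule span_subset [rotated], clarify)
      fix x y assume "x \<in> I 1" "y \<in> I 1"
      then obtain m n p q where xy: "x = b m * to_fract p"
          "y = b n * to_fract q"
        by (auto simp: mem)
      obtain p' q' where "b m = b (max m n) * to_fract p'"
        "b n = b (max m n) * to_fract q'"
        using chain [of m "max m n" 1] chain [of n "max m n" 1] by (auto simp: mem_principal_iff)
      then have "x * y = b (max m n) ^ 2 * to_fract (p' * p * (q' * q))"
        unfolding xy by (simp only: power2_eq_square to_fract_mult mult_ac)
      then show "x * y \<in> I 2"
        unfolding mem by blast
    qed
    show "I 2 \<subseteq> ideal_mult (I 1) (I 1)"
    proof
      fix z assume "z \<in> I 2"
      then obtain n r where z: "z = b n ^ 2 * to_fract r"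
        by (auto simp: mem)
      have "b n \<in> I 1" "b n * to_fract r \<in> I 1"
        using memI [of n 1 1] memI [of n 1 r] by simp_all
      moreover have "z = b n * (b n * to_fract r)"
        by (simp add: z power2_eq_square)
      ultimately show "z \<in> ideal_mult (I 1) (I 1)"
        unfolding ideal_mult_def by (blast intro: span_base)
    qed
  qed
  obtain c where c: "c \<noteq> 0" "I 2 = ideal_scale c (I 1)"
    using boole tI [of 1] tI [of 2] by (metis boole_t_regular_iff sq t_ideal_def)
  have "b 0 \<in> I 1"
    using memI [of 0 1 1] by simp
  then have "c * b 0 \<in> I 2"
    unfolding c ideal_scale_def by (rule imageI)
  then obtain m r where r: "c * b 0 =
      b m ^ 2 * to_fract r"
    by (auto simp: mem)
  have "b (Suc m) ^ 2 \<in> I 2"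
    using memI [of "Suc m" 2 1] by simp
  then obtain x where x: "x \<in> I 1" "b (Suc m) ^ 2 = c * x"
    unfolding c ideal_scale_def by (elim imageE)
  then obtain p q where q: "b (Suc m) ^ 2 = c * (b p * to_fract q)"
    by (auto simp: mem)
  have "b (Suc m) ^ 2 * b 0 = c * b 0 * (b p * to_fract q)"
    unfolding q by (simp only: mult_ac)
  also have "\<dots> = b m ^ 2 * b p * (to_fract r * to_fract q)"
    unfolding r by (simp only: mult_ac)
  finally have eq: "b (Suc m) ^ 2 * b 0 = b m ^ 2 * b p * (to_fract r * to_fract q)" .
  have key: "D\<^sup>2 * E = B\<^sup>2 * C * z"
    if "(A / B)\<^sup>2 * (A / C) = (A / D)\<^sup>2 * (A / E) * z" and nz: "A \<noteq> 0" "B \<noteq> 0" "C \<noteq> 0" "D \<noteq> 0" "E \<noteq> 0"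
    for A B C D E z :: "'a fract"
  proof -
    have "A ^ 3 * (D\<^sup>2 * E) = (A / B)\<^sup>2 * (A / C) * (B\<^sup>2 * C * (D\<^sup>2 * E))"
      using nz by (simp add: power_divide power2_eq_square power3_eq_cube)
    also have "\<dots> = (A / D)\<^sup>2 * (A / E) * z * (B\<^sup>2 * C * (D\<^sup>2 * E))"
      using that(1) by (rule arg_cong)
    also have "\<dots> = A ^ 3 * (B\<^sup>2 * C * z)"
      using nz by (simp add: power_divide power2_eq_square power3_eq_cube)
    finally show ?thesis
      using nz by simp
  qed
  have "to_fract (s m ^ 2 * s p) = to_fract (s (Suc m) ^ 2 * s 0 * (r * q))"
    using key [OF eq [unfolded b_def]] a s0 by (simp add: to_fract_power)
  then have "s m ^ 2 * s p = s (Suc m) ^ 2 * (s 0 * (r * q))"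
    by (simp only: to_fract_eq_iff mult.assoc)
  then have "s (Suc m) ^ 2 dvd s m ^ 2 * s p"
    by (rule dvdI)
  also have "\<dots> dvd s m ^ 2 * s (max (Suc m) p)"
    by (intro mult_dvd_mono mono) auto
  finally have dvd: "s (Suc m) ^ 2 dvd s m ^ 2 * s (max (Suc m) p)" .
  \<comment> \<open>Beyond \<open>s (Suc m)\<close> only factors coprime to \<open>u m\<close> are added, as \<open>u m\<close> divides each later \<open>s n\<close>.\<close>
  have "\<exists>q. s n = s (Suc m) * q \<and> v_coprime (u m) q" if "Suc m \<le> n" for n
    using that
  proof (induction rule: dec_induct)
    case base
    show ?case
      by (intro exI [of _ 1]) (simp add: v_coprime_iff)
  next
    case (step n)
    then obtain q where q: "s n = s (Suc m) * q" "v_coprime (u m) q"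
      by blast
    have "u m dvd s n"
      by (simp add: q s(2))
    then have "v_coprime (u m) (u n)"
      using v_coprime_dvd_right [OF u(1) [of n]] by (blast intro: v_gcd_sym)
    then show ?case
      using q by (intro exI [of _ "q * u n"]) (simp add: v_coprime_mult_right s(2) mult.assoc)
  qed
  then obtain q where q: "s (max (Suc m) p) = s (Suc m) * q" "v_coprime (u m) q"
    by (meson max.cobounded1)
  have "s m ^ 2 * u m * u m dvd s m ^ 2 * u m * (s m * q)"
    using dvd unfolding q(1) by (simp add: s(2) power2_eq_square mult_ac)
  moreover have "u m \<noteq> 0"
    using s0 [of "Suc m"] by (simp add: s(2))
  ultimately have "u m dvd s m * q"
    using s0 [of m] by simp
  then have "u m dvd 1"
    using q(2) u(1) by (meson v_coprime_dvd_imp_unit v_coprime_mult_right)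
  then show False
    using u(2) by blast
qed

theorem theorem2p3:
  assumes "v_domain TYPE('a :: idom)"
    and "boole_t_regular TYPE('a)"
  shows "gcd_domain TYPE('a) \<and> finite_t_character TYPE('a)"
proof
  have ex: "\<exists>g. v_gcd g x y" if "x \<noteq> 0 \<or> y \<noteq> 0" for x y :: 'a
    using v_gcd_exists [OF assms that] by blast
  then show "gcd_domain TYPE('a)"
    unfolding gcd_domain_def by (metis v_gcd_def v_gcd_greatest)
  show "finite_t_character TYPE('a)"
    unfolding finite_t_character_def
  proof (intro allI impI)
    fix I :: "'a fract set" assume I: "t_ideal I \<and> I \<subset> base_ring"
    then obtain a where a: "a \<noteq> 0" "to_fract a \<in> I"
      using t_ideal_nonzero_mem by blast
    have "finite {M. t_maximal M \<and> to_fract a \<in> M}"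
    proof (rule ccontr)
      assume "infinite {M. t_maximal M \<and> to_fract a \<in> M}"
      then show False
        using infinite_coprime_factors [OF ex a(1)]
          infinite_coprime_factors_not_boole [OF a(1)] assms(2) by metis
    qed
    then show "finite {M. t_maximal M \<and> I \<subseteq> M}"
      by (rule rev_finite_subset) (use a in auto)
  qed
qed

end
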